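(* Let $\mathcal{P}^+\subset\mathrm{Sym}^2(\mathbb{R}^n)$ be an elliptic cone and let $K$ be a compact subset of $\mathbb{R}^n$. If $u_1,u_2\in C(K)$ are both $\mathcal{P}^+$-partially pluriharmonic on the interior $\mathrm{Int}\,K$ of $K$, then $u_1=u_2$ on $\partial K$ implies $u_1=u_2$ on $K$.
   Context: $\mathrm{Sym}^2(\mathbb{R}^n)$ is the space of quadratic forms on $\mathbb{R}^n$ (real symmetric $n\times n$ matrices) with inner product $\langle A,B\rangle=\mathrm{tr}(AB)$. Cones. Let $\mathcal{P}^+\subset\mathrm{Sym}^2(\mathbb{R}^n)$ be a closed convex cone with vertex at the origin, with polar $\mathcal{P}_+=\{A:\langle A,B\rangle\ge0\ \forall B\in\mathcal{P}^+\}$. $\mathrm{Int}\,\mathcal{P}_+$ denotes the interior of $\mathcal{P}_+$ relative to its linear span. $\mathcal{P}^+$ is an elliptic cone if every $A\in\mathrm{Int}\,\mathcal{P}_+$ is positive definite. Plurisubharmonic functions. Let $X\subset\mathbb{R}^n$ be open. $\mathrm{USC}(X)$ is the set of upper semi-continuous functions $X\to[-\infty,\infty)$ not identically $-\infty$ on any connected component. A distribution $u$ on $X$ is $\mathcal{P}^+$-plurisubharmonic if $\Delta_A u:=\langle\mathrm{Hess}\,u,A\rangle\ge0$ (a non-negative measure) for every $A\in\mathcal{P}_+$. $\mathrm{PSH}(X)$ denotes the set of $u\in\mathrm{USC}(X)\cap L^1_{\rm loc}(X)$ which are $\mathcal{P}^+$-plurisubharmonic as distributions and satisfy $u(x)=\mathrm{ess}\limsup_{y\to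 x}u(y)$ for all $x\in X$. Subaffine functions. An upper semi-continuous $w:X\to[-\infty,\infty)$ is subaffine on $X$ if for every compact $C\subset X$ and every affine function $a$, $w\le a$ on $\partial C$ implies $w\le a$ on $C$. $\mathrm{SA}(X)$ is the set of such $w$ that are locally subaffine (each point has a neighborhood on which $w$ is subaffine); the function $\equiv-\infty$ is allowed. $\widetilde{\mathrm{PSH}}(X)$ is the set of $v\in\mathrm{USC}(X)$ such that $A+v\in\mathrm{SA}(X)$ for every $A\in\mathcal{P}^+$, where $A$ denotes the quadratic function $x\mapsto\langle Ax,x\rangle$. A function $u$ is $\mathcal{P}^+$-partially pluriharmonic on $X$ if $u\in\mathrm{PSH}(X)$ and $-u\in\widetilde{\mathrm{PSH}}(X)$. *)

theory Defs
  imports "HOL-Probability.Essential_Supremum"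
begin

section \<open>Cones of quadratic forms\<close>

definition Sym2 :: "(real^'n^'n) set" where
  "Sym2 = {A. transpose A = A}"

text \<open>The inner product on symmetric matrices; it agrees with \<open>\<bullet>\<close> there, so the
  ambient Euclidean topology of \<^typ>\<open>real^'n^'n\<close> is the one it induces.\<close>

definition form_inner :: "real^'n^'n \<Rightarrow> real^'n^'n \<Rightarrow> real" where
  "form_inner A B = trace (A ** B)"

definition polar_cone :: "(real^'n^'n) set \<Rightarrow> (real^'n^'n) set" where
  "polar_cone P = {A \<in> Sym2. \<forall>B\<in>P. 0 \<le> form_inner A B}"

definition relative_Int :: "(real^'n^'n) set \<Rightarrow> (real^'n^'n) set" where
  "relative_Int S = top_of_set (span S) interior_of S"

definition positive_definite :: "real^'n^'n \<Rightarrow> bool" where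
  "positive_definite A \<longleftrightarrow> A \<in> Sym2 \<and> (\<forall>x. x \<noteq> 0 \<longrightarrow> 0 < (A *v x) \<bullet> x)"

definition elliptic_cone :: "(real^'n^'n) set \<Rightarrow> bool" where
  "elliptic_cone P \<longleftrightarrow> P \<subseteq> Sym2 \<and> closed P \<and> convex_cone P \<and>
     (\<forall>A \<in> relative_Int (polar_cone P). positive_definite A)"


section \<open>Test functions and distributions\<close>

definition partial_deriv :: "'n \<Rightarrow> (real^'n \<Rightarrow> real) \<Rightarrow> real^'n \<Rightarrow> real" where
  "partial_deriv i f = (\<lambda>x. frechet_derivative f (at x) (axis i 1))"

text \<open>All iterated partial derivatives exist and are differentiable, hence continuous.\<close>

definition smooth :: "(real^'n \<Rightarrow> real) \<Rightarrow> bool" where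
  "smooth f \<longleftrightarrow> (\<forall>js. foldr partial_deriv js f differentiable_on UNIV)"

definition test_functions :: "(real^'n) set \<Rightarrow> (real^'n \<Rightarrow> real) set" where
  "test_functions X = {\<phi>. smooth \<phi> \<and>
     compact (closure {x. \<phi> x \<noteq> 0}) \<and> closure {x. \<phi> x \<noteq> 0} \<subseteq> X}"

text \<open>A distribution on \<open>X\<close> is represented by its action on \<^term>\<open>test_functions X\<close>.
  Linearity and continuity are not part of the type; they hold automatically for
  the distribution given by a locally integrable function and for its derivatives,
  which are the only ones used below.\<close>

type_synonym 'n distr = "(real^'n \<Rightarrow> real) \<Rightarrow> real"

definition distr_partial :: "'n \<Rightarrow> ('n::finite) distr \<Rightarrow> ('n::finite) distr" where
  "distr_partial i T = (\<lambda>\<phi>. - T (partial_deriv i \<phi>))"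

definition distr_Hess :: "('n::finite) distr \<Rightarrow> (real^'n \<Rightarrow> real) \<Rightarrow> real^'n^'n" where
  "distr_Hess T \<phi> = (\<chi> i j. distr_partial i (distr_partial j T) \<phi>)"

definition distr_Laplacian :: "real^'n^'n \<Rightarrow> ('n::finite) distr \<Rightarrow> ('n::finite) distr" where
  "distr_Laplacian A T = (\<lambda>\<phi>. form_inner (distr_Hess T \<phi>) A)"

definition distr_nonneg :: "(real^'n) set \<Rightarrow> ('n::finite) distr \<Rightarrow> bool" where
  "distr_nonneg X T \<longleftrightarrow> (\<forall>\<phi> \<in> test_functions X. (\<forall>x. 0 \<le> \<phi> x) \<longrightarrow> 0 \<le> T \<phi>)"

definition psh_distr :: "(real^'n^'n) set \<Rightarrow> (real^'n) set \<Rightarrow> ('n::finite) distr \<Rightarrow> bool" where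
  "psh_distr P X T \<longleftrightarrow> (\<forall>A \<in> polar_cone P. distr_nonneg X (distr_Laplacian A T))"


section \<open>Function classes\<close>

text \<open>Functions \<open>X \<rightarrow> [-\<infinity>, \<infinity>)\<close> are total functions into \<^typ>\<open>ereal\<close>; values off \<open>X\<close> are irrelevant.\<close>

definition upper_semicontinuous :: "(real^'n) set \<Rightarrow> (real^'n \<Rightarrow> ereal) \<Rightarrow> bool" where
  "upper_semicontinuous X u \<longleftrightarrow> (\<forall>x\<in>X. u x < \<infinity>) \<and>
     (\<forall>c. openin (top_of_set X) {x \<in> X. u x < c})"

definition USC :: "(real^'n) set \<Rightarrow> (real^'n \<Rightarrow> ereal) set" where
  "USC X = {u. upper_semicontinuous X u \<and>
     (\<forall>C \<in> components X. \<exists>x\<in>C. u x \<noteq> -\<infinity>)}"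

text \<open>The almost-everywhere condition is needed because \<^const>\<open>real_of_ereal\<close> sends
  infinite values to \<open>0\<close>.\<close>

definition L1_loc :: "(real^'n) set \<Rightarrow> (real^'n \<Rightarrow> ereal) set" where
  "L1_loc X = {u. \<forall>C. compact C \<and> C \<subseteq> X \<longrightarrow>
     (AE x in lebesgue. x \<in> C \<longrightarrow> \<bar>u x\<bar> \<noteq> \<infinity>) \<and>
     set_integrable lebesgue C (\<lambda>x. real_of_ereal (u x))}"

definition regular_distr :: "(real^'n) set \<Rightarrow> (real^'n \<Rightarrow> ereal) \<Rightarrow> ('n::finite) distr" where
  "regular_distr X u = (\<lambda>\<phi>. LINT x:X|lebesgue. real_of_ereal (u x) * \<phi> x)"

definition ess_limsup :: "(real^'n) set \<Rightarrow> (real^'n \<Rightarrow> ereal) \<Rightarrow> real^'n \<Rightarrow> ereal" where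
  "ess_limsup X u x = (INF r\<in>{0<..}. esssup (restrict_space lebesgue (X \<inter> ball x r)) u)"

definition PSH :: "(real^'n^'n) set \<Rightarrow> (real^'n) set \<Rightarrow> (real^'n \<Rightarrow> ereal) set" where
  "PSH P X = {u \<in> USC X \<inter> L1_loc X.
     psh_distr P X (regular_distr X u) \<and> (\<forall>x\<in>X. u x = ess_limsup X u x)}"

definition affine_fun :: "(real^'n \<Rightarrow> real) \<Rightarrow> bool" where
  "affine_fun a \<longleftrightarrow> (\<exists>l c. linear l \<and> a = (\<lambda>x. l x + c))"

definition subaffine :: "(real^'n) set \<Rightarrow> (real^'n \<Rightarrow> ereal) \<Rightarrow> bool" where
  "subaffine X w \<longleftrightarrow> upper_semicontinuous X w \<and>
     (\<forall>C a. compact C \<and> C \<subseteq> X \<and> affine_fun a \<and> (\<forall>x\<in>frontier C. w x \<le> ereal (a x)) \<longrightarrow>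
        (\<forall>x\<in>C. w x \<le> ereal (a x)))"

definition SA :: "(real^'n) set \<Rightarrow> (real^'n \<Rightarrow> ereal) set" where
  "SA X = {w. upper_semicontinuous X w \<and>
     (\<forall>x\<in>X. \<exists>U. open U \<and> x \<in> U \<and> U \<subseteq> X \<and> subaffine U w)}"

definition PSH_tilde :: "(real^'n^'n) set \<Rightarrow> (real^'n) set \<Rightarrow> (real^'n \<Rightarrow> ereal) set" where
  "PSH_tilde P X = {v \<in> USC X. \<forall>A\<in>P. (\<lambda>x. ereal ((A *v x) \<bullet> x) + v x) \<in> SA X}"

definition partially_pluriharmonic ::
    "(real^'n^'n) set \<Rightarrow> (real^'n) set \<Rightarrow> (real^'n \<Rightarrow> ereal) \<Rightarrow> bool" where
  "partially_pluriharmonic P X u \<longleftrightarrow> u \<in> PSH P X \<and> (\<lambda>x. - u x) \<in> PSH_tilde P X"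

end

theory Submission
  imports Defs
begin

text \<open>The theorem follows from a maximum principle for \<open>u - v\<close>, applied to
  \<open>(u\<^sub>1, u\<^sub>2)\<close> and to \<open>(u\<^sub>2, u\<^sub>1)\<close>: if \<open>u\<close> is plurisubharmonic as a distribution and
  \<open>- v\<close> lies in \<open>PSH_tilde\<close>, then \<open>u \<le> v\<close> on the frontier of \<open>K\<close> forces \<open>u \<le> v\<close>
  on \<open>K\<close> (\<open>comparison_principle\<close>).

  Suppose first that \<open>u\<close> is smooth. Then its Hessian lies in the cone at each point. If the
  principle fails, \<open>u - v + \<epsilon> |x|\<^sup>2\<close> has an interior maximum \<open>x\<^sub>0\<close> for small \<open>\<epsilon> > 0\<close>. Let \<open>A\<close> be
  half of the Hessian of \<open>u\<close> at \<open>x\<^sub>0\<close>. By Taylor's formula, \<open>A - v\<close> lies below an affine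
  function near \<open>x\<^sub>0\<close>, with equality at \<open>x\<^sub>0\<close>, by a margin of at least \<open>\<epsilon> |x - x\<^sub>0|\<^sup>2\<close> up
  to a term of third order. This is impossible for a subaffine function
  (\<open>subaffine_no_strict_touching\<close>), whereas \<open>A - v\<close> is locally subaffine since \<open>A\<close> lies in
  the cone.

  In general \<open>u\<close> is replaced by its mollifications, which approximate the continuous
  function \<open>u\<close> uniformly on compact subsets of the interior (\<open>mollify_error\<close>). The quadratic
  part of the Taylor expansion of a mollification is, up to a positive factor, the
  distributional Hessian of \<open>u\<close> at the translated kernel (\<open>mollify_taylor\<close>).
  Plurisubharmonicity says that this matrix pairs non-negatively with the polar cone, so by
  the bipolar theorem (\<open>symmetric_part_mem_cone\<close>) its symmetric part belongs to the cone
  itself.\<close>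

section \<open>The bipolar theorem\<close>

lemma form_inner_eq_inner: "form_inner A B = A \<bullet> transpose B"
  by (simp add: form_inner_def trace_def matrix_matrix_mult_def inner_vec_def transpose_def)

lemma inner_transpose: "transpose A \<bullet> transpose B = A \<bullet> (B :: real^'n^'n)"
  unfolding inner_vec_def transpose_def by (simp, rule sum.swap)

text \<open>A hyperplane separating the symmetric part of \<open>Q\<close> from the
  cone has a normal \<open>a\<close> that is non-negative on the cone; its symmetric part then lies in the
  polar, because pairing with a symmetric matrix only sees the symmetric part, and it
  would pair negatively with \<open>Q\<close>. Passing to symmetric parts spares a proof that
  Hessians are symmetric.\<close>

lemma symmetric_part_mem_cone:
  fixes P :: "(real^'n^'n) set"
  assumes P: "P \<subseteq> Sym2" "closed P" "convex_cone P"
    and Q: "\<And>A. A \<in> polar_cone P \<Longrightarrow> 0 \<le> form_inner Q A"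
  shows "(1/2) *\<^sub>R (Q + transpose Q) \<in> P"
proof (rule ccontr)
  let ?S = "(1/2) *\<^sub>R (Q + transpose Q)"
  assume "?S \<notin> P"
  moreover have "convex P"
    using P(3) by (simp add: convex_cone_def)
  ultimately obtain a b where ab: "a \<bullet> ?S < b" "\<And>B. B \<in> P \<Longrightarrow> b < a \<bullet> B"
    using separating_hyperplane_closed_point[of P ?S] P(2) by auto
  have b: "b < 0"
    using ab(2)[OF convex_cone_contains_0[OF P(3)]] by simp
  have pos: "0 \<le> a \<bullet> B" if B: "B \<in> P" for B
  proof (rule ccontr)
    assume "\<not> 0 \<le> a \<bullet> B"
    then have neg: "a \<bullet> B < 0" by simp
    have "(b / (a \<bullet> B)) *\<^sub>R B \<in> P"
      using P(3) B neg b by (intro convex_cone_scaleR) (auto simp: divide_nonpos_neg)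
    from ab(2)[OF this] neg show False by simp
  qed
  define A where "A = (1/2) *\<^sub>R (a + transpose a)"
  have tr: "transpose (X + Y) = transpose X + transpose Y" "transpose (c *\<^sub>R X) = c *\<^sub>R transpose X"
    for X Y :: "real^'n^'n" and c
    by (simp_all add: transpose_def vec_eq_iff)
  have A_sym: "transpose A = A"
    by (simp add: A_def tr add.commute)
  have A_inner: "A \<bullet> B = a \<bullet> ((1/2) *\<^sub>R (B + transpose B))" for B
    using inner_transpose[of a "transpose B"] by (simp add: A_def inner_add_left inner_add_right)
  have "A \<in> polar_cone P"
  proof -
    have "0 \<le> form_inner A B" if B: "B \<in> P" for B
    proof -
      have "transpose B = B" using P(1) B by (auto simp: Sym2_def)
      then have "form_inner A B = a \<bullet> B"
        by (simp add: form_inner_eq_inner A_inner flip: scaleR_2)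
      with pos[OF B] show ?thesis by simp
    qed
    then show ?thesis using A_sym by (simp add: polar_cone_def Sym2_def)
  qed
  from Q[OF this] have "0 \<le> Q \<bullet> A"
    by (simp add: form_inner_eq_inner A_sym)
  also have "Q \<bullet> A = a \<bullet> ?S"
    using A_inner[of Q] by (simp add: inner_commute)
  finally show False using ab(1) b by simp
qed

section \<open>Bump functions with small support\<close>

text \<open>The function \<open>t\<^sup>-\<^sup>k e\<^sup>-\<^sup>1\<^sup>/\<^sup>t\<close>, extended by \<open>0\<close> to \<open>t \<le> 0\<close>. All powers are carried along
  so that derivatives stay in the linear span of the family.\<close>

definition flat :: "nat \<Rightarrow> real \<Rightarrow> real" where
  "flat k t = (if t > 0 then inverse t ^ k / exp (inverse t) else 0)"

lemma flat_tendsto_0: "(flat k \<longlongrightarrow> 0) (at 0)"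
proof -
  have "((\<lambda>t. inverse t ^ k / exp (inverse t)) \<longlongrightarrow> (0::real)) (at_right 0)"
    by (rule filterlim_compose[OF tendsto_power_div_exp_0 filterlim_inverse_at_top_right])
  then have "(flat k \<longlongrightarrow> 0) (at_right 0)"
    by (rule Lim_transform_eventually)
      (auto simp: flat_def eventually_at intro!: exI[of _ 1])
  moreover have "(flat k \<longlongrightarrow> 0) (at_left 0)"
    by (rule Lim_transform_eventually[OF tendsto_const])
      (auto simp: flat_def eventually_at intro!: exI[of _ 1])
  ultimately show ?thesis by (simp add: filterlim_split_at)
qed

lemma flat_deriv:
  "(flat k has_real_derivative flat (k + 2) t - real k * flat (k + 1) t) (at t)"
proof -
  consider "t < 0" | "t = 0" | "t > 0" by linarith
  then show ?thesis
  proof cases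
    case 1
    have "((\<lambda>_. 0) has_real_derivative 0) (at t)" by simp
    then have "(flat k has_real_derivative 0) (at t)"
      by (rule has_field_derivative_transform_within_open[where S = "{..<0}"])
        (use 1 in \<open>auto simp: flat_def\<close>)
    with 1 show ?thesis by (simp add: flat_def)
  next
    case 2
    have "(flat k has_real_derivative 0) (at 0)"
      unfolding has_field_derivative_iff
      by (rule Lim_transform_eventually[OF flat_tendsto_0[of "Suc k"]])
        (auto simp: flat_def eventually_at field_simps intro!: exI[of _ 1])
    with 2 show ?thesis by (simp add: flat_def)
  next
    case 3
    have "((\<lambda>t. inverse t ^ k / exp (inverse t)) has_real_derivative
        (real k * inverse t ^ (k - 1) * (- (inverse t ^ 2)) * exp (inverse t)
          - inverse t ^ k * (exp (inverse t) * (- (inverse t ^ 2)))) / exp (inverse t) ^ 2) (at t)"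
      by (rule derivative_eq_intros refl | use 3 in \<open>simp add: power2_eq_square numeral_2_eq_2\<close>)+
    also have "(real k * inverse t ^ (k - 1) * (- (inverse t ^ 2)) * exp (inverse t)
          - inverse t ^ k * (exp (inverse t) * (- (inverse t ^ 2)))) / exp (inverse t) ^ 2
        = flat (k + 2) t - real k * flat (k + 1) t"
      using 3 by (cases k) (auto simp: flat_def power2_eq_square field_simps)
    finally show ?thesis
      by (rule has_field_derivative_transform_within_open[where S = "{0<..}"])
        (use 3 in \<open>auto simp: flat_def\<close>)
  qed
qed

text \<open>Functions on the line that vanish outside \<open>[-r, r]\<close>. The set is closed under
  differentiation, so its members have derivatives of all orders, and it contains a
  function that is positive on \<open>(-r, r)\<close>.\<close>

inductive_set bumps :: "real \<Rightarrow> (real \<Rightarrow> real) set" for r where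
  bumps_base: "(\<lambda>t. flat k (r + t) * flat l (r - t)) \<in> bumps r"
| bumps_add: "f \<in> bumps r \<Longrightarrow> g \<in> bumps r \<Longrightarrow> (\<lambda>t. f t + g t) \<in> bumps r"
| bumps_scale: "f \<in> bumps r \<Longrightarrow> (\<lambda>t. c * f t) \<in> bumps r"

lemma bumps_deriv:
  "f \<in> bumps r \<Longrightarrow> \<exists>f' \<in> bumps r. \<forall>t. (f has_real_derivative f' t) (at t)"
proof (induction rule: bumps.induct)
  case (bumps_base k l)
  let ?b = "\<lambda>k l t. flat k (r + t) * flat l (r - t)"
  let ?f' = "\<lambda>t. (?b (k + 2) l t + (- real k) * ?b (k + 1) l t)
      + ((-1) * ?b k (l + 2) t + real l * ?b k (l + 1) t)"
  have "(?b k l has_real_derivative ?f' t) (at t)" for t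
  proof -
    have "((\<lambda>t. flat k (r + t)) has_real_derivative
        (flat (k + 2) (r + t) - real k * flat (k + 1) (r + t)) * 1) (at t)"
      by (rule DERIV_chain2[OF flat_deriv]) (auto intro!: derivative_eq_intros)
    moreover have "((\<lambda>t. flat l (r - t)) has_real_derivative
        (flat (l + 2) (r - t) - real l * flat (l + 1) (r - t)) * (-1)) (at t)"
      by (rule DERIV_chain2[OF flat_deriv]) (auto intro!: derivative_eq_intros)
    ultimately show ?thesis
      by (auto intro!: derivative_eq_intros simp: algebra_simps)
  qed
  moreover have "?f' \<in> bumps r"
    by (intro bumps.intros)
  ultimately show ?case by (intro bexI[of _ ?f'] allI)
next
  case (bumps_add f g)
  then obtain f' g' where "f' \<in> bumps r" "g' \<in> bumps r"
    "\<And>t. (f has_real_derivative f' t) (at t)" "\<And>t. (g has_real_derivative g' t) (at t)"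
    by blast
  then show ?case
    by (intro bexI[of _ "\<lambda>t. f' t + g' t"]) (auto intro!: derivative_eq_intros bumps.intros)
next
  case (bumps_scale f c)
  then obtain f' where "f' \<in> bumps r" "\<And>t. (f has_real_derivative f' t) (at t)"
    by blast
  then show ?case
    by (intro bexI[of _ "\<lambda>t. c * f' t"]) (auto intro!: derivative_eq_intros bumps.intros)
qed

lemma partial_deriv_eq:
  assumes "(f has_derivative f') (at x)"
  shows "partial_deriv i f x = f' (axis i 1)"
  using frechet_derivative_at[OF assms] by (simp add: partial_deriv_def)

definition prod_bumps :: "real \<Rightarrow> (real^'n \<Rightarrow> real) set" where
  "prod_bumps r = {f. \<exists>g. (\<forall>i. g i \<in> bumps r) \<and> f = (\<lambda>x. \<Prod>i\<in>UNIV. g i (x $ i))}"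

text \<open>A partial derivative of a product of one-variable functions differentiates a single
  factor, so it is again such a product.\<close>

lemma prod_bumps_deriv:
  assumes "f \<in> prod_bumps r"
  shows "f differentiable_on UNIV" and "partial_deriv i f \<in> prod_bumps r"
proof -
  from assms obtain g where g: "\<And>i. g i \<in> bumps r" "f = (\<lambda>x. \<Prod>i\<in>UNIV. g i (x $ i))"
    by (auto simp: prod_bumps_def)
  from bumps_deriv[OF g(1)] have "\<forall>i. \<exists>f'. f' \<in> bumps r \<and> (\<forall>t. (g i has_real_derivative f' t) (at t))"
    by blast
  then obtain g' where g': "\<And>i. g' i \<in> bumps r" "\<And>i t. (g i has_real_derivative g' i t) (at t)"
    by metis
  have "((\<lambda>x. g i (x $ i)) has_derivative (\<lambda>h. (h $ i) * g' i (x $ i))) (at x)" for i x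
    using has_derivative_compose[where f = "\<lambda>x. x $ i" and f' = "\<lambda>h. h $ i" and s = UNIV,
        OF bounded_linear_imp_has_derivative[OF bounded_linear_vec_nth]
        g'(2)[of i, unfolded has_field_derivative_def]]
    by (simp add: mult.commute)
  then have D: "(f has_derivative
      (\<lambda>h. \<Sum>i\<in>UNIV. (h $ i) * g' i (x $ i) * (\<Prod>j\<in>UNIV - {i}. g j (x $ j)))) (at x)" for x
    unfolding g(2) by (rule has_derivative_prod)
  then show "f differentiable_on UNIV"
    by (auto simp: differentiable_on_def differentiable_def)
  have "partial_deriv i f = (\<lambda>x. \<Prod>j\<in>UNIV. (g(i := g' i)) j (x $ j))"
  proof
    fix x
    have "partial_deriv i f x =
        (\<Sum>k\<in>UNIV. if k = i then g' k (x $ k) * (\<Prod>j\<in>UNIV - {k}. g j (x $ j)) else 0)"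
      unfolding partial_deriv_eq[OF D] by (intro sum.cong) (auto simp: axis_def)
    also have "\<dots> = g' i (x $ i) * (\<Prod>j\<in>UNIV - {i}. g j (x $ j))"
      by simp
    also have "\<dots> = (\<Prod>j\<in>UNIV. (g(i := g' i)) j (x $ j))"
      by (subst prod.remove[of UNIV i]) auto
    finally show "partial_deriv i f x = (\<Prod>j\<in>UNIV. (g(i := g' i)) j (x $ j))" .
  qed
  then show "partial_deriv i f \<in> prod_bumps r"
    using g(1) g'(1) by (auto simp: prod_bumps_def intro!: exI[of _ "g(i := g' i)"])
qed

lemma prod_bumps_smooth: "f \<in> prod_bumps r \<Longrightarrow> smooth f"
proof -
  assume f: "f \<in> prod_bumps r"
  have "foldr partial_deriv js f \<in> prod_bumps r" for js
    by (induction js) (auto simp: f prod_bumps_deriv(2))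
  then show ?thesis unfolding smooth_def using prod_bumps_deriv(1) by blast
qed

lemma mollifier_exists:
  assumes "e > 0"
  obtains \<phi> :: "real^'n \<Rightarrow> real" where "smooth \<phi>" "\<And>x. 0 \<le> \<phi> x" "0 < \<phi> 0" "\<And>x. \<phi> x \<noteq> 0 \<Longrightarrow> norm x \<le> e"
proof
  \<comment> \<open>The cube with half-side \<open>r\<close> is contained in the ball of radius \<open>e\<close>.\<close>
  define r where "r = e / real CARD('n)"
  have r: "r > 0" using assms by (simp add: r_def)
  let ?\<phi> = "\<lambda>x::real^'n. \<Prod>i\<in>UNIV. flat 0 (r + x $ i) * flat 0 (r - x $ i)"
  have "?\<phi> \<in> prod_bumps r"
    unfolding prod_bumps_def using bumps_base[of 0 r 0]
    by (auto intro!: exI[of _ "\<lambda>i t. flat 0 (r + t) * flat 0 (r - t)"])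
  then show "smooth ?\<phi>" by (rule prod_bumps_smooth)
  show "0 \<le> ?\<phi> x" for x by (intro prod_nonneg) (auto simp: flat_def)
  show "0 < ?\<phi> 0" using r by (intro prod_pos) (auto simp: flat_def)
  show "norm x \<le> e" if "?\<phi> x \<noteq> 0" for x
  proof -
    have "\<bar>x $ i\<bar> \<le> r" for i
    proof -
      have "flat 0 (r + x $ i) * flat 0 (r - x $ i) \<noteq> 0"
        using that by auto
      then show ?thesis by (auto simp: flat_def split: if_splits)
    qed
    then have "(\<Sum>i\<in>UNIV. \<bar>x $ i\<bar>) \<le> real CARD('n) * r"
      using sum_bounded_above[of UNIV "\<lambda>i. \<bar>x $ i\<bar>" r] by simp
    then show ?thesis using norm_le_l1_cart[of x] by (simp add: r_def)
  qed
qed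

section \<open>Smooth functions and Taylor's formula\<close>

lemma smooth_partial: "smooth f \<Longrightarrow> smooth (partial_deriv i f)"
  unfolding smooth_def
proof
  fix js assume "\<forall>js. foldr partial_deriv js f differentiable_on UNIV"
  from spec[OF this, of "js @ [i]"]
  show "foldr partial_deriv js (partial_deriv i f) differentiable_on UNIV" by simp
qed

lemma smooth_differentiable: "smooth f \<Longrightarrow> f differentiable (at x)"
proof -
  assume "smooth f"
  then have "foldr partial_deriv [] f differentiable_on UNIV" unfolding smooth_def by blast
  then show ?thesis by (simp add: differentiable_on_def)
qed

lemma smooth_continuous: "smooth f \<Longrightarrow> continuous_on S f"
  by (simp add: smooth_differentiable differentiable_imp_continuous_within continuous_at_imp_continuous_on)

lemma smooth_has_derivative:
  assumes "smooth f"
  shows "(f has_derivative (\<lambda>h. \<Sum>i\<in>UNIV. h $ i * partial_deriv i f x)) (at x)"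
proof -
  let ?D = "frechet_derivative f (at x)"
  have D: "(f has_derivative ?D) (at x)"
    using smooth_differentiable[OF assms] by (simp add: frechet_derivative_works)
  then have lin: "linear ?D" by (rule has_derivative_linear)
  have "?D h = (\<Sum>i\<in>UNIV. h $ i * partial_deriv i f x)" for h
  proof -
    have "?D h = ?D (\<Sum>i\<in>UNIV. h $ i *s axis i 1)" by (simp add: basis_expansion)
    also have "\<dots> = (\<Sum>i\<in>UNIV. h $ i * partial_deriv i f x)"
      by (simp add: linear_sum[OF lin] linear_cmul[OF lin] partial_deriv_def
          scalar_mult_eq_scaleR)
    finally show ?thesis .
  qed
  then have "?D = (\<lambda>h. \<Sum>i\<in>UNIV. h $ i * partial_deriv i f x)" by blast
  with D show ?thesis by simp
qed

lemma smooth_line_deriv: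
  assumes "smooth f"
  shows "((\<lambda>t. f (x + t *\<^sub>R h)) has_real_derivative
      (\<Sum>i\<in>UNIV. h $ i * partial_deriv i f (x + t *\<^sub>R h))) (at t)"
proof -
  have "((\<lambda>t. x + t *\<^sub>R h) has_derivative (\<lambda>s. s *\<^sub>R h)) (at t)"
    by (auto intro!: derivative_eq_intros)
  from has_derivative_compose[OF this smooth_has_derivative[OF assms]]
  show ?thesis
    unfolding has_field_derivative_def
    by (rule has_derivative_eq_rhs) (simp add: fun_eq_iff sum_distrib_left mult_ac)
qed

text \<open>Taylor's formula along the segment from \<open>x\<close> to \<open>x + h\<close>. The constant does not depend
  on \<open>x\<close>, which is what permits integrating the formula over \<open>x\<close>.\<close>

lemma smooth_taylor:
  fixes f :: "real^'n \<Rightarrow> real"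
  assumes f: "smooth f"
    and B: "\<And>i j k x. \<bar>partial_deriv k (partial_deriv j (partial_deriv i f)) x\<bar> \<le> B"
  shows "\<bar>f (x + h) - f x - (\<Sum>i\<in>UNIV. h $ i * partial_deriv i f x)
      - (1/2) * (\<Sum>i\<in>UNIV. h $ i * (\<Sum>j\<in>UNIV. h $ j * partial_deriv j (partial_deriv i f) x))\<bar>
    \<le> real CARD('n) ^ 3 * B * norm h ^ 3"
proof -
  note sm = f smooth_partial[OF f] smooth_partial[OF smooth_partial[OF f]]
  let ?z = "\<lambda>t. x + t *\<^sub>R h"
  define d0 where "d0 = (\<lambda>t. f (?z t))"
  define d1 where "d1 = (\<lambda>t. \<Sum>i\<in>UNIV. h $ i * partial_deriv i f (?z t))"
  define d2 where "d2 = (\<lambda>t. \<Sum>i\<in>UNIV. h $ i * (\<Sum>j\<in>UNIV. h $ j * partial_deriv j (partial_deriv i f) (?z t)))"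
  define d3 where "d3 = (\<lambda>t. \<Sum>i\<in>UNIV. h $ i * (\<Sum>j\<in>UNIV. h $ j *
      (\<Sum>k\<in>UNIV. h $ k * partial_deriv k (partial_deriv j (partial_deriv i f)) (?z t))))"
  define diff where "diff = (\<lambda>m::nat. if m = 0 then d0 else if m = 1 then d1 else if m = 2 then d2 else d3)"
  have "(d0 has_real_derivative d1 t) (at t)" for t
    unfolding d0_def d1_def by (rule smooth_line_deriv[OF sm(1)])
  moreover have "(d1 has_real_derivative d2 t) (at t)" for t
    unfolding d1_def d2_def by (intro DERIV_sum DERIV_cmult smooth_line_deriv sm)
  moreover have "(d2 has_real_derivative d3 t) (at t)" for t
    unfolding d2_def d3_def by (intro DERIV_sum DERIV_cmult smooth_line_deriv sm)
  ultimately have "\<forall>m t. m < 3 \<and> 0 \<le> t \<and> t \<le> 1 \<longrightarrow> DERIV (diff m) t :> diff (Suc m) t"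
    by (auto simp: diff_def)
  from Maclaurin[where diff = diff and f = d0 and h = 1 and n = 3, OF _ _ _ this] obtain t where
    t: "d0 1 = (\<Sum>m<3. (diff m 0 / fact m) * 1 ^ m) + (diff 3 t / fact 3) * 1 ^ 3"
    by (auto simp: diff_def)
  have bound: "\<bar>\<Sum>i\<in>UNIV. h $ i * c i\<bar> \<le> real CARD('n) * norm h * M"
    if "\<And>i. \<bar>c i\<bar> \<le> M" for c :: "'n \<Rightarrow> real" and M
  proof -
    have "\<bar>\<Sum>i\<in>UNIV. h $ i * c i\<bar> \<le> (\<Sum>i\<in>UNIV. \<bar>h $ i * c i\<bar>)" by (rule sum_abs)
    also have "\<dots> \<le> (\<Sum>i\<in>(UNIV::'n set). norm h * M)"
      by (intro sum_mono) (auto simp: abs_mult intro!: mult_mono component_le_norm_cart that)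
    finally show ?thesis by simp
  qed
  have "\<bar>d3 t\<bar> \<le> real CARD('n) * norm h * (real CARD('n) * norm h * (real CARD('n) * norm h * B))"
    unfolding d3_def by (intro bound B)
  also have "\<dots> = real CARD('n) ^ 3 * B * norm h ^ 3"
    by (simp add: power3_eq_cube)
  finally have d3: "\<bar>d3 t\<bar> \<le> real CARD('n) ^ 3 * B * norm h ^ 3" .
  have "d0 1 - d0 0 - d1 0 - (1/2) * d2 0 = d3 t / 6"
    using t by (simp add: diff_def eval_nat_numeral)
  with d3 have "\<bar>d0 1 - d0 0 - d1 0 - (1/2) * d2 0\<bar> \<le> real CARD('n) ^ 3 * B * norm h ^ 3"
    by linarith
  then show ?thesis by (simp add: d0_def d1_def d2_def)
qed

lemma partial_deriv_translate:
  assumes "smooth f"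
  shows "partial_deriv i (\<lambda>y. f (y - a)) = (\<lambda>y. partial_deriv i f (y - a))"
proof
  fix y
  have "((\<lambda>y. y - a) has_derivative (\<lambda>h. h)) (at y)"
    by (auto intro!: derivative_eq_intros)
  from has_derivative_compose[OF this smooth_has_derivative[OF assms]]
  show "partial_deriv i (\<lambda>y. f (y - a)) y = partial_deriv i f (y - a)"
    using partial_deriv_eq[OF smooth_has_derivative[OF assms], of i "y - a"]
    by (subst partial_deriv_eq) auto
qed

lemma smooth_translate:
  assumes "smooth f"
  shows "smooth (\<lambda>y. f (y - a))"
proof -
  have "smooth (foldr partial_deriv js f) \<and>
      foldr partial_deriv js (\<lambda>y. f (y - a)) = (\<lambda>y. foldr partial_deriv js f (y - a))" for js
    by (induction js) (auto simp: assms partial_deriv_translate smooth_partial)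
  moreover have "(\<lambda>y. g (y - a)) differentiable_on UNIV" if "smooth g" for g :: "real^'a \<Rightarrow> real"
  proof -
    have "((\<lambda>y. y - a) has_derivative (\<lambda>h. h)) (at y)" for y
      by (auto intro!: derivative_eq_intros)
    from has_derivative_compose[OF this smooth_has_derivative[OF that]]
    show ?thesis by (auto simp: differentiable_on_def differentiable_def)
  qed
  ultimately show ?thesis unfolding smooth_def by metis
qed

lemma partial_deriv_support:
  assumes "\<And>x. e < norm x \<Longrightarrow> f x = 0" and "e < norm x"
  shows "partial_deriv i f x = 0"
proof -
  have "((\<lambda>_. 0) has_derivative (\<lambda>_. 0)) (at x)" by simp
  then have "(f has_derivative (\<lambda>_. 0)) (at x)"
  proof (rule has_derivative_transform_within_open[where s = "{x. e < norm x}"])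
    show "open {x::real^'a. e < norm x}" by (intro open_Collect_less continuous_intros)
  qed (use assms in auto)
  from partial_deriv_eq[OF this] show ?thesis .
qed

lemma smooth_bounded:
  fixes f :: "real^'n \<Rightarrow> real"
  assumes "smooth f" and "\<And>x. e < norm x \<Longrightarrow> f x = 0"
  obtains B where "0 \<le> B" "\<And>x. \<bar>f x\<bar> \<le> B"
proof -
  have "bounded (f ` cball 0 e)"
    by (intro compact_imp_bounded compact_continuous_image smooth_continuous assms(1) compact_cball)
  then obtain B where "\<forall>x\<in>cball 0 e. \<bar>f x\<bar> \<le> B"
    unfolding bounded_iff by auto
  then have B: "\<bar>f x\<bar> \<le> B" if "x \<in> cball 0 e" for x
    using that by blast
  have "\<bar>f x\<bar> \<le> max B 0" for x
    using B[of x] assms(2)[of x] by (cases "e < norm x") auto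
  then show ?thesis using that[of "max B 0"] by simp
qed

section \<open>Mollification\<close>

text \<open>Convolution of \<open>u\<close> with the reflected kernel, written so that the kernel is the
  translate \<open>y \<mapsto> \<phi> (y - x)\<close>, the test function to which the distribution \<open>u\<close> is applied. The kernel
  need not have integral \<open>1\<close>.\<close>

definition mollify :: "(real^'n) set \<Rightarrow> (real^'n \<Rightarrow> real) \<Rightarrow> (real^'n \<Rightarrow> real) \<Rightarrow> real^'n \<Rightarrow> real" where
  "mollify X \<phi> u x = (LINT y:X|lebesgue. u y * \<phi> (y - x))"

lemma set_integrable_mult_bounded:
  fixes u \<psi> :: "real^'n \<Rightarrow> real"
  assumes u: "set_integrable lebesgue X u" and \<psi>: "continuous_on UNIV \<psi>" "\<And>x. \<bar>\<psi> x\<bar> \<le> B"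
  shows "set_integrable lebesgue X (\<lambda>y. u y * \<psi> y)"
    and "\<bar>LINT y:X|lebesgue. u y * \<psi> y\<bar> \<le> (LINT y:X|lebesgue. \<bar>u y\<bar>) * B"
proof -
  have B: "0 \<le> B" using \<psi>(2)[of 0] by linarith
  have m: "\<psi> \<in> borel_measurable lebesgue"
    using borel_measurable_continuous_onI[OF \<psi>(1)] by (simp add: measurable_completion)
  have iu: "integrable lebesgue (\<lambda>y. (indicat_real X y *\<^sub>R u y) * B)"
    using u unfolding set_integrable_def by simp
  have le: "norm (indicat_real X y *\<^sub>R (u y * \<psi> y)) \<le> norm ((indicat_real X y *\<^sub>R u y) * B)" for y
    using \<psi>(2)[of y] B by (auto simp: abs_mult indicator_def intro!: mult_left_mono)
  have "(\<lambda>y. (indicat_real X y *\<^sub>R u y) * \<psi> y) \<in> borel_measurable lebesgue"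
    using u m unfolding set_integrable_def by measurable
  then have "(\<lambda>y. indicat_real X y *\<^sub>R (u y * \<psi> y)) \<in> borel_measurable lebesgue"
    by (simp add: mult.assoc)
  with iu show i: "set_integrable lebesgue X (\<lambda>y. u y * \<psi> y)"
    unfolding set_integrable_def by (rule Bochner_Integration.integrable_bound) (use le in auto)
  have "\<bar>LINT y:X|lebesgue. u y * \<psi> y\<bar> \<le> (LINT y|lebesgue. norm (indicat_real X y *\<^sub>R (u y * \<psi> y)))"
    unfolding set_lebesgue_integral_def using integral_norm_bound[of lebesgue "\<lambda>y. indicat_real X y *\<^sub>R (u y * \<psi> y)"]
    by simp
  also have "\<dots> \<le> (LINT y|lebesgue. norm ((indicat_real X y *\<^sub>R u y) * B))"
    using i iu unfolding set_integrable_def by (intro integral_mono integrable_norm) (use le in auto)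
  also have "\<dots> = (LINT y:X|lebesgue. \<bar>u y\<bar>) * B"
    using B by (simp add: set_lebesgue_integral_def abs_mult flip: integral_mult_left_zero)
  finally show "\<bar>LINT y:X|lebesgue. u y * \<psi> y\<bar> \<le> (LINT y:X|lebesgue. \<bar>u y\<bar>) * B" .
qed

text \<open>Expanding the kernel under the integral gives the second order part of a mollification
  without differentiating an integral twice. Its matrix is the distributional Hessian of \<open>u\<close>
  tested against the translated kernel, which is what plurisubharmonicity controls.\<close>

lemma mollify_taylor:
  fixes u \<phi> :: "real^'n \<Rightarrow> real" and x :: "real^'n"
  assumes u: "set_integrable lebesgue X u"
    and \<phi>: "smooth \<phi>" "\<And>x. e < norm x \<Longrightarrow> \<phi> x = 0"
  defines "H \<equiv> distr_Hess (\<lambda>\<psi>. LINT y:X|lebesgue. u y * \<psi> y) (\<lambda>y. \<phi> (y - x))"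
  shows "\<exists>b C. \<forall>h. \<bar>mollify X \<phi> u (x + h) - mollify X \<phi> u x - b \<bullet> h - (1/2) * ((H *v h) \<bullet> h)\<bar>
      \<le> C * norm h ^ 3"
proof -
  define T where "T = (\<lambda>\<psi>. LINT y:X|lebesgue. u y * \<psi> y)"
  let ?d = "\<lambda>i. partial_deriv i \<phi>"
  let ?dd = "\<lambda>i j. partial_deriv j (partial_deriv i \<phi>)"
  let ?ddd = "\<lambda>i j k. partial_deriv k (partial_deriv j (partial_deriv i \<phi>))"
  note sm = \<phi>(1) smooth_partial[OF \<phi>(1)] smooth_partial[OF smooth_partial[OF \<phi>(1)]]
  have s1: "e < norm y \<Longrightarrow> ?d i y = 0" for i y
    by (rule partial_deriv_support[OF \<phi>(2)])
  have s2: "e < norm y \<Longrightarrow> ?dd i j y = 0" for i j y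
    by (rule partial_deriv_support[OF s1])
  have s3: "e < norm y \<Longrightarrow> ?ddd i j k y = 0" for i j k y
    by (rule partial_deriv_support[OF s2])
  have int_supp: "set_integrable lebesgue X (\<lambda>y. u y * f (y - a))"
    if f: "smooth f" "\<And>y. e < norm y \<Longrightarrow> f y = 0" for f a
  proof -
    obtain B where "\<And>y. \<bar>f y\<bar> \<le> B" using smooth_bounded[OF f] by metis
    then show ?thesis
      by (intro set_integrable_mult_bounded(1)[OF u smooth_continuous[OF smooth_translate[OF f(1)]]])
  qed
  have "\<exists>B\<ge>0. \<forall>y. \<bar>?ddd i j k y\<bar> \<le> B" for i j k
    using smooth_bounded[OF smooth_partial[OF sm(3)] s3] by metis
  then have ex: "\<exists>B. 0 \<le> B \<and> (\<forall>y. \<bar>?ddd i j k y\<bar> \<le> B)" for i j k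
    by blast
  define B0 where "B0 = (\<lambda>i j k. SOME B. 0 \<le> B \<and> (\<forall>y. \<bar>?ddd i j k y\<bar> \<le> B))"
  have B0: "0 \<le> B0 i j k" "\<bar>?ddd i j k y\<bar> \<le> B0 i j k" for i j k y
    using someI_ex[OF ex[of k j i]] unfolding B0_def by blast+
  define B where "B = (\<Sum>i\<in>UNIV. \<Sum>j\<in>UNIV. \<Sum>k\<in>UNIV. B0 i j k)"
  have B: "\<bar>?ddd i j k y\<bar> \<le> B" for i j k y
  proof -
    have "B0 i j k \<le> (\<Sum>k\<in>UNIV. B0 i j k)"
      by (rule member_le_sum) (auto simp: B0)
    also have "\<dots> \<le> (\<Sum>j\<in>UNIV. \<Sum>k\<in>UNIV. B0 i j k)"
      by (rule member_le_sum[where f = "\<lambda>j. \<Sum>k\<in>UNIV. B0 i j k"]) (auto simp: B0 sum_nonneg)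
    also have "\<dots> \<le> B"
      unfolding B_def
      by (rule member_le_sum[where f = "\<lambda>i. \<Sum>j\<in>UNIV. \<Sum>k\<in>UNIV. B0 i j k"]) (auto simp: B0 sum_nonneg)
    finally show ?thesis using B0(2)[of k j i y] by linarith
  qed
  \<comment> \<open>The sign arises because moving \<open>x\<close> by \<open>h\<close> moves the argument of the kernel by \<open>- h\<close>.\<close>
  define b where "b = (\<chi> i. - T (\<lambda>y. ?d i (y - x)))"
  have H: "H $ i $ j = T (\<lambda>y. ?dd i j (y - x))" for i j
    by (simp add: H_def T_def distr_Hess_def distr_partial_def partial_deriv_translate sm)
  define C where "C = (LINT y:X|lebesgue. \<bar>u y\<bar>) * (real CARD('n) ^ 3 * B)"
  have "\<bar>mollify X \<phi> u (x + h) - mollify X \<phi> u x - b \<bullet> h - (1/2) * ((H *v h) \<bullet> h)\<bar>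
      \<le> C * norm h ^ 3" for h
  proof -
    define R where "R = (\<lambda>y. \<phi> (y - (x + h)) - \<phi> (y - x) + (\<Sum>i\<in>UNIV. h $ i * ?d i (y - x))
      - (1/2) * (\<Sum>i\<in>UNIV. h $ i * (\<Sum>j\<in>UNIV. h $ j * ?dd i j (y - x))))"
    have R_le: "\<bar>R y\<bar> \<le> real CARD('n) ^ 3 * B * norm h ^ 3" for y
      using smooth_taylor[OF \<phi>(1) B, of "y - x" "- h"]
      by (simp add: R_def sum_negf algebra_simps)
    have R_cont: "continuous_on UNIV R"
      unfolding R_def
      by (intro continuous_intros smooth_continuous smooth_translate sm)
    have "\<bar>T R\<bar> \<le> C * norm h ^ 3"
      using set_integrable_mult_bounded(2)[OF u R_cont R_le] by (simp add: T_def C_def mult.assoc)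
    moreover have "T R = mollify X \<phi> u (x + h) - mollify X \<phi> u x - b \<bullet> h - (1/2) * ((H *v h) \<bullet> h)"
    proof -
      have i: "integrable lebesgue (\<lambda>y. indicat_real X y * (u y * \<phi> (y - a)))"
        "integrable lebesgue (\<lambda>y. indicat_real X y * (u y * ?d i (y - a)))"
        "integrable lebesgue (\<lambda>y. indicat_real X y * (u y * ?dd i j (y - a)))" for a i j
        using int_supp[OF sm(1) \<phi>(2)] int_supp[OF sm(2) s1] int_supp[OF sm(3) s2]
        by (simp_all add: set_integrable_def)
      have R_eq: "indicat_real X y * (u y * R y) = indicat_real X y * (u y * \<phi> (y - (x + h)))
          - indicat_real X y * (u y * \<phi> (y - x))
          + (\<Sum>i\<in>UNIV. h $ i * (indicat_real X y * (u y * ?d i (y - x))))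
          - (1/2) * (\<Sum>i\<in>UNIV. h $ i * (\<Sum>j\<in>UNIV. h $ j * (indicat_real X y * (u y * ?dd i j (y - x)))))" for y
        unfolding R_def by (simp add: algebra_simps sum_distrib_left)
      have "T R = mollify X \<phi> u (x + h) - mollify X \<phi> u x
          + (\<Sum>i\<in>UNIV. h $ i * T (\<lambda>y. ?d i (y - x)))
          - (1/2) * (\<Sum>i\<in>UNIV. h $ i * (\<Sum>j\<in>UNIV. h $ j * T (\<lambda>y. ?dd i j (y - x))))"
        unfolding T_def mollify_def set_lebesgue_integral_def real_scaleR_def R_eq
        using i by simp
      also have "(\<Sum>i\<in>UNIV. h $ i * T (\<lambda>y. ?d i (y - x))) = - (b \<bullet> h)"
        by (simp add: b_def inner_vec_def sum_negf mult.commute)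
      also have "(\<Sum>i\<in>UNIV. h $ i * (\<Sum>j\<in>UNIV. h $ j * T (\<lambda>y. ?dd i j (y - x)))) = (H *v h) \<bullet> h"
        by (simp add: inner_vec_def matrix_vector_mult_def H sum_distrib_left sum_distrib_right mult_ac)
      finally show ?thesis by simp
    qed
    ultimately show ?thesis by simp
  qed
  then show ?thesis by blast
qed

lemma translated_test_function:
  assumes \<phi>: "smooth \<phi>" "\<And>x. e < norm x \<Longrightarrow> \<phi> x = 0" and "cball x e \<subseteq> X"
  shows "(\<lambda>y. \<phi> (y - x)) \<in> test_functions X"
proof -
  have "{y. \<phi> (y - x) \<noteq> 0} \<subseteq> cball x e"
  proof
    fix y assume "y \<in> {y. \<phi> (y - x) \<noteq> 0}"
    with \<phi>(2)[of "y - x"] show "y \<in> cball x e"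
      by (force simp: dist_norm norm_minus_commute)
  qed
  then have "closure {y. \<phi> (y - x) \<noteq> 0} \<subseteq> cball x e"
    by (simp add: closure_minimal)
  moreover from this have "compact (closure {y. \<phi> (y - x) \<noteq> 0})"
    by (meson bounded_cball bounded_subset closed_closure compact_eq_bounded_closed)
  ultimately show ?thesis
    using assms by (auto simp: test_functions_def smooth_translate)
qed

lemma integrable_smooth_bump:
  fixes \<phi> :: "real^'n \<Rightarrow> real"
  assumes \<phi>: "smooth \<phi>" "\<And>x. e < norm x \<Longrightarrow> \<phi> x = 0"
  shows "integrable lebesgue \<phi>"
proof -
  have "integrable lborel (\<lambda>x. indicat_real (cball 0 e) x *\<^sub>R \<phi> x)"
    by (intro borel_integrable_compact smooth_continuous \<phi>(1) compact_cball)
  also have "(\<lambda>x. indicat_real (cball 0 e) x *\<^sub>R \<phi> x) = \<phi>"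
    using \<phi>(2) by (fastforce simp: indicator_def)
  finally show ?thesis
    using smooth_continuous[OF \<phi>(1)]
    by (simp add: integrable_completion borel_measurable_continuous_onI)
qed

text \<open>The kernel at \<open>x\<close> lives on \<open>cball x e\<close>, where \<open>u\<close> differs from \<open>u x\<close> by at most \<open>\<omega>\<close>. Its
  total mass does not depend on \<open>x\<close> by translation invariance of Lebesgue measure.\<close>

lemma mollify_error:
  fixes u \<phi> :: "real^'n \<Rightarrow> real"
  assumes u: "set_integrable lebesgue X u"
    and \<phi>: "smooth \<phi>" "\<And>x. 0 \<le> \<phi> x" "\<And>x. e < norm x \<Longrightarrow> \<phi> x = 0"
    and X: "cball x e \<subseteq> X"
    and osc: "\<And>y. y \<in> cball x e \<Longrightarrow> \<bar>u y - u x\<bar> \<le> \<omega>"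
  shows "\<bar>mollify X \<phi> u x - integral\<^sup>L lebesgue \<phi> * u x\<bar> \<le> integral\<^sup>L lebesgue \<phi> * \<omega>"
proof -
  obtain B where B: "\<And>y. \<bar>\<phi> y\<bar> \<le> B" using smooth_bounded[OF \<phi>(1,3)] by metis
  have z: "\<phi> (y - x) = 0" if "y \<notin> cball x e" for y
    using that by (intro \<phi>(3)) (simp add: dist_norm norm_minus_commute)
  have m: "(\<lambda>y. \<phi> (y - x)) \<in> borel_measurable lborel" "\<phi> \<in> borel_measurable lborel"
    using smooth_continuous[OF \<phi>(1)] smooth_continuous[OF smooth_translate[OF \<phi>(1)]]
    by (simp_all add: borel_measurable_continuous_onI)
  have 1: "integral\<^sup>L lebesgue \<phi> = integral\<^sup>L lebesgue (\<lambda>y. \<phi> (y - x))"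
  proof -
    have "integral\<^sup>L lebesgue \<phi> = integral\<^sup>L (distr lborel borel ((+) (-x))) \<phi>"
      unfolding lborel_distr_plus using m by (simp add: integral_completion)
    also have "\<dots> = integral\<^sup>L lborel (\<lambda>y. \<phi> (y - x))"
      using m by (subst integral_distr) auto
    finally show ?thesis using m by (simp add: integral_completion)
  qed
  have i\<phi>: "integrable lebesgue (\<lambda>y. \<phi> (y - x))"
  proof (rule integrable_smooth_bump[where e = "e + norm x"])
    show "\<phi> (y - x) = 0" if "e + norm x < norm y" for y
      using \<phi>(3)[of "y - x"] that norm_triangle_ineq2[of y x] by simp
  qed (rule smooth_translate[OF \<phi>(1)])
  have iu: "integrable lebesgue (\<lambda>y. indicat_real X y * (u y * \<phi> (y - x)))"
    using set_integrable_mult_bounded(1)[OF u smooth_continuous[OF smooth_translate[OF \<phi>(1)]] B]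
    by (simp add: set_integrable_def)
  have "mollify X \<phi> u x - integral\<^sup>L lebesgue \<phi> * u x
      = (LINT y|lebesgue. indicat_real X y * (u y * \<phi> (y - x)) - \<phi> (y - x) * u x)"
    using iu i\<phi> by (simp add: mollify_def set_lebesgue_integral_def 1)
  also have "\<bar>\<dots>\<bar> \<le> (LINT y|lebesgue. \<bar>indicat_real X y * (u y * \<phi> (y - x)) - \<phi> (y - x) * u x\<bar>)"
    using integral_norm_bound[of lebesgue "\<lambda>y. indicat_real X y * (u y * \<phi> (y - x)) - \<phi> (y - x) * u x"] by simp
  also have "\<dots> \<le> (LINT y|lebesgue. \<phi> (y - x) * \<omega>)"
  proof (intro integral_mono integrable_abs Bochner_Integration.integrable_diff iu integrable_mult_left i\<phi>)
    fix y
    show "\<bar>indicat_real X y * (u y * \<phi> (y - x)) - \<phi> (y - x) * u x\<bar> \<le> \<phi> (y - x) * \<omega>"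
    proof (cases "y \<in> cball x e")
      case True
      with X have "indicat_real X y * (u y * \<phi> (y - x)) - \<phi> (y - x) * u x = \<phi> (y - x) * (u y - u x)"
        by (auto simp: algebra_simps)
      then show ?thesis
        using osc[OF True] \<phi>(2)[of "y - x"] by (simp add: abs_mult mult_left_mono)
    next
      case False
      then show ?thesis by (simp add: z)
    qed
  qed
  also have "\<dots> = integral\<^sup>L lebesgue \<phi> * \<omega>" by (simp add: 1)
  finally show ?thesis .
qed

lemma integral_mollifier_pos:
  fixes \<phi> :: "real^'n \<Rightarrow> real"
  assumes \<phi>: "smooth \<phi>" "\<And>x. 0 \<le> \<phi> x" "0 < \<phi> 0" "\<And>x. e < norm x \<Longrightarrow> \<phi> x = 0"
  shows "0 < integral\<^sup>L lebesgue \<phi>"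
proof -
  have "integral\<^sup>L lebesgue \<phi> \<noteq> 0"
  proof
    assume "integral\<^sup>L lebesgue \<phi> = 0"
    then have "AE x in lebesgue. \<phi> x = 0"
      using integral_nonneg_eq_0_iff_AE[OF integrable_smooth_bump[OF \<phi>(1,4)]] \<phi>(2) by simp
    moreover have op: "open {x. \<phi> x \<noteq> 0}"
      by (intro open_Collect_neq smooth_continuous \<phi>(1) continuous_on_const)
    ultimately have "negligible {x. \<phi> x \<noteq> 0}"
      using AE_iff_null_sets[of "{x. \<phi> x \<noteq> 0}" lebesgue] by (simp add: negligible_iff_null_sets borel_open)
    moreover note op
    moreover have "0 \<in> {x. \<phi> x \<noteq> 0}" using \<phi>(3) by simp
    ultimately show False using open_not_negligible by blast
  qed
  moreover have "0 \<le> integral\<^sup>L lebesgue \<phi>" using \<phi>(2) by simp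
  ultimately show ?thesis by linarith
qed

lemma mollify_continuous:
  fixes u \<phi> :: "real^'n \<Rightarrow> real"
  assumes "set_integrable lebesgue X u" and "smooth \<phi>" "\<And>x. e < norm x \<Longrightarrow> \<phi> x = 0"
  shows "continuous_on S (mollify X \<phi> u)"
proof -
  let ?F = "mollify X \<phi> u"
  have "isCont ?F x" for x
  proof -
    define H where "H = distr_Hess (\<lambda>\<psi>. LINT y:X|lebesgue. u y * \<psi> y) (\<lambda>y. \<phi> (y - x))"
    obtain b C where T: "\<And>h. \<bar>?F (x + h) - ?F x - b \<bullet> h - (1/2) * ((H *v h) \<bullet> h)\<bar> \<le> C * norm h ^ 3"
      using mollify_taylor[OF assms, where x = x, folded H_def] by blast
    have "((\<lambda>h. b \<bullet> h + (1/2) * ((H *v h) \<bullet> h)) \<longlongrightarrow> 0) (at 0)"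
    proof -
      have "isCont (\<lambda>h. b \<bullet> h + (1/2) * ((H *v h) \<bullet> h)) 0"
        by (intro continuous_intros bounded_linear.continuous[OF matrix_vector_mul_bounded_linear])
      then show ?thesis by (simp add: isCont_def)
    qed
    moreover have "((\<lambda>h. ?F (x + h) - ?F x - b \<bullet> h - (1/2) * ((H *v h) \<bullet> h)) \<longlongrightarrow> 0) (at 0)"
    proof (rule Lim_null_comparison)
      show "\<forall>\<^sub>F h in at 0. norm (?F (x + h) - ?F x - b \<bullet> h - (1/2) * ((H *v h) \<bullet> h)) \<le> C * norm h ^ 3"
        using T by simp
      show "((\<lambda>h::real^'n. C * norm h ^ 3) \<longlongrightarrow> 0) (at 0)"
      proof -
        have "isCont (\<lambda>h::real^'n. C * norm h ^ 3) 0" by (intro continuous_intros)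
        then show ?thesis by (simp add: isCont_def)
      qed
    qed
    ultimately have "((\<lambda>h. ?F (x + h) - ?F x) \<longlongrightarrow> 0) (at 0)"
      by (auto dest: tendsto_add)
    then show ?thesis
      by (simp add: isCont_iff Lim_null[symmetric])
  qed
  then show ?thesis by (simp add: continuous_at_imp_continuous_on)
qed

section \<open>The comparison principle\<close>

text \<open>On a sphere around \<open>x0\<close> so small that the quadratic term dominates the cubic one, \<open>f\<close>
  would lie below \<open>a\<close> minus a positive constant. That function is affine, so the inequality
  would persist at the centre, where \<open>f\<close> and \<open>a\<close> agree.\<close>

lemma subaffine_no_strict_touching:
  fixes f a :: "real^'n \<Rightarrow> real"
  assumes sub: "subaffine U (\<lambda>x. ereal (f x))" and U: "open U" "x0 \<in> U"
    and a: "affine_fun a" "a x0 = f x0" and \<epsilon>: "0 < \<epsilon>" and d: "0 < d"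
    and touch: "\<And>x. x \<in> cball x0 d \<Longrightarrow>
      f x \<le> a x - \<epsilon> * norm (x - x0) ^ 2 + C * norm (x - x0) ^ 3"
  shows False
proof -
  obtain d' where d': "0 < d'" "cball x0 d' \<subseteq> U"
    using U open_contains_cball by blast
  define r where "r = min (min d d') (\<epsilon> / (2 * (\<bar>C\<bar> + 1)))"
  have r: "0 < r" "r \<le> d" "cball x0 r \<subseteq> U"
    using d d' \<epsilon> by (auto simp: r_def)
  have "r * (\<bar>C\<bar> + 1) \<le> \<epsilon> / (2 * (\<bar>C\<bar> + 1)) * (\<bar>C\<bar> + 1)"
    by (rule mult_right_mono) (auto simp: r_def)
  also have "\<dots> = \<epsilon> / 2" by (simp add: field_simps)
  finally have "r * (\<bar>C\<bar> + 1) \<le> \<epsilon> / 2" .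
  moreover have "C * r \<le> r * (\<bar>C\<bar> + 1)" using r(1) by (simp add: mult.commute mult_left_mono)
  ultimately have "C * r \<le> \<epsilon> / 2" by linarith
  then have "C * r * r ^ 2 \<le> \<epsilon> / 2 * r ^ 2" by (rule mult_right_mono) simp
  then have Cr: "C * r ^ 3 \<le> \<epsilon> / 2 * r ^ 2" by (simp add: power3_eq_cube power2_eq_square)
  define a' where "a' = (\<lambda>x. a x - \<epsilon> / 2 * r ^ 2)"
  obtain l c where "linear l" "a = (\<lambda>x. l x + c)"
    using a(1) by (auto simp: affine_fun_def)
  then have "affine_fun a'"
    unfolding affine_fun_def a'_def
    by (intro exI[of _ l] exI[of _ "c - \<epsilon> / 2 * r ^ 2"]) (simp add: add_diff_eq)
  moreover have "\<forall>x\<in>frontier (cball x0 r). ereal (f x) \<le> ereal (a' x)"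
  proof
    fix x assume "x \<in> frontier (cball x0 r)"
    then have n: "norm (x - x0) = r" by (simp add: dist_norm norm_minus_commute)
    then have "x \<in> cball x0 d" using r(2) by (simp add: dist_norm norm_minus_commute)
    from touch[OF this] Cr show "ereal (f x) \<le> ereal (a' x)" by (simp add: n a'_def)
  qed
  moreover have "compact (cball x0 r) \<and> cball x0 r \<subseteq> U \<and> affine_fun a' \<and>
      (\<forall>x\<in>frontier (cball x0 r). ereal (f x) \<le> ereal (a' x)) \<longrightarrow>
      (\<forall>x\<in>cball x0 r. ereal (f x) \<le> ereal (a' x))"
    using sub unfolding subaffine_def by (elim conjE allE)
  ultimately have "\<forall>x\<in>cball x0 r. ereal (f x) \<le> ereal (a' x)"
    using r(3) compact_cball by (elim mp) (intro conjI)
  then have "f x0 \<le> a' x0" using r(1) by auto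
  then have "\<epsilon> * r ^ 2 \<le> 0" by (simp add: a'_def a(2))
  moreover have "0 < \<epsilon> * r ^ 2" using \<epsilon> r(1) by simp
  ultimately show False by linarith
qed

lemma quadratic_symmetric_part:
  fixes H :: "real^'n^'n"
  shows "((1/2) *\<^sub>R (H + transpose H) *v h) \<bullet> h = (H *v h) \<bullet> h"
proof -
  have "(transpose H *v h) \<bullet> h = (H *v h) \<bullet> h"
    by (simp add: inner_commute flip: dot_lmul_matrix)
  then show ?thesis
    by (simp add: scaleR_matrix_vector_assoc[symmetric] matrix_vector_mult_add_rdistrib inner_add_left)
qed

text \<open>The perturbation \<open>\<epsilon> |x|\<^sup>2\<close> makes the touching at a maximum strict, and \<open>\<epsilon>\<close> is so small
  that the maximum over \<open>K\<close> stays off the frontier. The set \<open>C\<close>, where the perturbed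
  difference \<open>g\<close> is near its maximum, is compact in the interior, so there is room to mollify
  \<open>u\<close> on it. If \<open>U\<close> is within \<open>\<omega>\<close> of \<open>u\<close> on \<open>C\<close>, then the perturbed difference \<open>G\<close> formed
  with \<open>U\<close> has its maximum over \<open>C\<close> at a point in the interior of \<open>C\<close>. The Taylor expansion
  of \<open>U\<close> at that point contradicts \<open>subaffine_no_strict_touching\<close>.\<close>

lemma comparison_principle:
  fixes P :: "(real^'n^'n) set" and K :: "(real^'n) set" and u v :: "real^'n \<Rightarrow> real"
  assumes P: "P \<subseteq> Sym2" "closed P" "convex_cone P"
    and K: "compact K" and cont: "continuous_on K u" "continuous_on K v"
    and psh: "psh_distr P (interior K) (regular_distr (interior K) (\<lambda>x. ereal (u x)))"
    and tilde: "(\<lambda>x. - ereal (v x)) \<in> PSH_tilde P (interior K)"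
    and bd: "\<And>x. x \<in> frontier K \<Longrightarrow> u x \<le> v x"
    and "z \<in> K"
  shows "u z \<le> v z"
proof (rule ccontr)
  assume "\<not> u z \<le> v z"
  define X where "X = interior K"
  have X: "open X" "X \<subseteq> K" by (auto simp: X_def interior_subset)
  obtain R where R: "0 < R" "\<And>x. x \<in> K \<Longrightarrow> norm x \<le> R"
    using compact_imp_bounded[OF K] by (auto simp: bounded_pos)
  \<comment> \<open>\<open>s\<close> bounds \<open>g\<close> on the frontier, and is less than \<open>g z\<close>.\<close>
  define s where "s = (u z - v z) / 2"
  define \<epsilon> where "\<epsilon> = s / R ^ 2"
  have s: "0 < s" using \<open>\<not> u z \<le> v z\<close> by (simp add: s_def)
  have \<epsilon>: "0 < \<epsilon>" "\<epsilon> * R ^ 2 = s" using s R(1) by (auto simp: \<epsilon>_def)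
  define g where "g = (\<lambda>x. u x - v x + \<epsilon> * norm x ^ 2)"
  have g_cont: "continuous_on K g" unfolding g_def by (intro continuous_intros cont)
  obtain zm where zm: "zm \<in> K" "\<And>x. x \<in> K \<Longrightarrow> g x \<le> g zm"
    using continuous_attains_sup[OF K _ g_cont] \<open>z \<in> K\<close> by blast
  define m where "m = g zm"
  have m: "s < m"
  proof -
    have "s < u z - v z" using s by (simp add: s_def)
    also have "\<dots> \<le> g z" using \<epsilon>(1) by (simp add: g_def)
    also have "\<dots> \<le> m" using zm(2)[OF \<open>z \<in> K\<close>] by (simp add: m_def)
    finally show ?thesis .
  qed
  define C where "C = K \<inter> g -` {(m + s) / 2..}"
  have "closed C"
    unfolding C_def by (rule continuous_closed_preimage[OF g_cont compact_imp_closed[OF K] closed_atLeast])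
  then have C: "compact C"
    using K by (metis C_def compact_Int_closed inf.absorb_iff2 inf_le1)
  have CX: "C \<subseteq> X"
  proof
    fix x assume x: "x \<in> C"
    show "x \<in> X"
    proof (rule ccontr)
      assume "x \<notin> X"
      with x have "x \<in> frontier K"
        using closure_subset by (auto simp: frontier_def C_def X_def)
      moreover have "norm x ^ 2 \<le> R ^ 2" using R(2)[of x] x by (simp add: C_def power_mono)
      then have "\<epsilon> * norm x ^ 2 \<le> s" using \<epsilon> by (metis less_imp_le mult_left_mono)
      ultimately have "g x \<le> s" using bd[of x] by (simp add: g_def)
      with x m show False by (simp add: C_def)
    qed
  qed
  have "zm \<in> C" using zm m by (simp add: C_def m_def)
  \<comment> \<open>Mollifying costs \<open>2 \<omega>\<close> at the maximum, which must be less than the drop \<open>(m - s) / 2\<close>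
    that defines \<open>C\<close>.\<close>
  define \<omega> where "\<omega> = (m - s) / 9"
  have \<omega>: "0 < \<omega>" using m by (simp add: \<omega>_def)
  obtain e1 where e1: "0 < e1" and "(\<Union>x\<in>C. cball x e1) \<subseteq> X"
    using compact_subset_open_imp_cball_epsilon_subset[OF C X(1) CX] by metis
  then have e1_sub: "cball x e1 \<subseteq> X" if "x \<in> C" for x
    using that by blast
  obtain e2 where e2: "0 < e2" "\<And>x y. x \<in> K \<Longrightarrow> y \<in> K \<Longrightarrow> dist y x < e2 \<Longrightarrow> dist (u y) (u x) < \<omega>"
    using compact_uniformly_continuous[OF cont(1) K] \<omega> unfolding uniformly_continuous_on_def by blast
  define e where "e = min e1 (e2 / 2)"
  have e: "0 < e" "e \<le> e1" "e < e2" using e1 e2(1) by (auto simp: e_def)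
  obtain \<phi> :: "real^'n \<Rightarrow> real" where \<phi>: "smooth \<phi>" "\<And>x. 0 \<le> \<phi> x" "0 < \<phi> 0" "\<And>x. \<phi> x \<noteq> 0 \<Longrightarrow> norm x \<le> e"
    using mollifier_exists[OF e(1)] by metis
  have supp: "\<phi> x = 0" if "e < norm x" for x using \<phi>(4)[of x] that by fastforce
  define M where "M = integral\<^sup>L lebesgue \<phi>"
  have M: "0 < M" unfolding M_def by (rule integral_mollifier_pos[OF \<phi>(1,2,3) supp])
  have u_int: "set_integrable lebesgue X u"
  proof -
    have "set_integrable lborel K u"
      using borel_integrable_compact[OF K cont(1)] by (simp add: set_integrable_def)
    then have "set_integrable lborel X u"
      by (rule set_integrable_subset) (use X in auto)
    then show ?thesis
      by (auto simp: set_integrable_def integrable_completion)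
  qed
  define U where "U = (\<lambda>x. mollify X \<phi> u x / M)"
  have U_err: "\<bar>U x - u x\<bar> \<le> \<omega>" if x: "x \<in> C" for x
  proof -
    have sub: "cball x e \<subseteq> X" using e1_sub[OF x] e(2) by auto
    have "\<bar>u y - u x\<bar> \<le> \<omega>" if "y \<in> cball x e" for y
      using e2(2)[of x y] that sub X(2) x e(3) by (force simp: C_def dist_real_def dist_commute)
    then have "\<bar>mollify X \<phi> u x - M * u x\<bar> \<le> M * \<omega>"
      unfolding M_def by (intro mollify_error[OF u_int \<phi>(1,2) supp sub])
    moreover have "mollify X \<phi> u x - M * u x = M * (U x - u x)"
      using M by (simp add: U_def field_simps)
    ultimately show ?thesis using M by (simp add: abs_mult)
  qed
  define G where "G = (\<lambda>x. U x - v x + \<epsilon> * norm x ^ 2)"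
  have "continuous_on C G"
    unfolding G_def U_def using M
    by (intro continuous_intros mollify_continuous[OF u_int \<phi>(1) supp] continuous_on_subset[OF cont(2)])
      (auto simp: C_def)
  then obtain x0 where x0: "x0 \<in> C" "\<And>x. x \<in> C \<Longrightarrow> G x \<le> G x0"
    using continuous_attains_sup[OF C] \<open>zm \<in> C\<close> by blast
  have Gg: "\<bar>G x - g x\<bar> \<le> \<omega>" if "x \<in> C" for x
    using U_err[OF that] by (simp add: G_def g_def)
  have "(m + s) / 2 < g x0"
  proof -
    have "m - \<omega> \<le> G zm" using Gg[OF \<open>zm \<in> C\<close>] by (simp add: m_def abs_le_iff)
    also have "\<dots> \<le> G x0" by (rule x0(2)[OF \<open>zm \<in> C\<close>])
    also have "\<dots> \<le> g x0 + \<omega>" using Gg[OF x0(1)] by (simp add: abs_le_iff)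
    finally have "m - 2 * \<omega> \<le> g x0" by simp
    moreover have "(m + s) / 2 < m - 2 * \<omega>" using m by (simp add: \<omega>_def field_simps)
    ultimately show ?thesis by simp
  qed
  moreover have "open (X \<inter> g -` {(m + s) / 2<..})"
    by (rule continuous_open_preimage[OF continuous_on_subset[OF g_cont X(2)] X(1) open_greaterThan])
  ultimately obtain d where d: "0 < d" "cball x0 d \<subseteq> X \<inter> g -` {(m + s) / 2<..}"
    using open_contains_cball[of "X \<inter> g -` {(m + s) / 2<..}"] x0(1) CX by blast
  have dC: "cball x0 d \<subseteq> C" using d(2) X(2) by (fastforce simp: C_def)
  define H where "H = distr_Hess (\<lambda>\<psi>. LINT y:X|lebesgue. u y * \<psi> y) (\<lambda>y. \<phi> (y - x0))"
  obtain b B where T: "\<And>h. \<bar>mollify X \<phi> u (x0 + h) - mollify X \<phi> u x0 - b \<bullet> h - (1/2) * ((H *v h) \<bullet> h)\<bar>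
      \<le> B * norm h ^ 3"
    using mollify_taylor[OF u_int \<phi>(1) supp, where x = x0, folded H_def] by blast
  define S where "S = (1/2) *\<^sub>R (H + transpose H)"
  have "S \<in> P"
    unfolding S_def
  proof (rule symmetric_part_mem_cone[OF P])
    fix A assume A: "A \<in> polar_cone P"
    have "cball x0 e \<subseteq> X" using e1_sub[OF x0(1)] e(2) by auto
    from translated_test_function[OF \<phi>(1) supp this] show "0 \<le> form_inner H A"
      using psh A \<phi>(2)
      by (auto simp: psh_distr_def distr_nonneg_def distr_Laplacian_def regular_distr_def H_def X_def)
  qed
  \<comment> \<open>The quadratic part of the Taylor expansion of \<open>U\<close>: the factor \<open>1/2\<close> is Taylor's,
    and \<open>M\<close> normalizes the kernel.\<close>
  define A where "A = (1 / (2 * M)) *\<^sub>R S"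
  have A: "A \<in> P"
    unfolding A_def using M \<open>S \<in> P\<close> by (intro convex_cone_scaleR[OF P(3)]) auto
  have A_quad: "(A *v h) \<bullet> h = (1 / (2 * M)) * ((H *v h) \<bullet> h)" for h
    unfolding A_def scaleR_matrix_vector_assoc[symmetric] inner_scaleR_left
    by (simp only: S_def quadratic_symmetric_part)
  have T': "U x0 + (b \<bullet> h) / M + (A *v h) \<bullet> h - (B / M) * norm h ^ 3 \<le> U (x0 + h)" for h
  proof -
    have "M * (U x0 + (b \<bullet> h) / M + (A *v h) \<bullet> h - (B / M) * norm h ^ 3) \<le> M * U (x0 + h)"
      using T[of h] M by (simp add: U_def A_quad distrib_left right_diff_distrib abs_le_iff)
    then show ?thesis using M by simp
  qed
  obtain W where W: "open W" "x0 \<in> W" "subaffine W (\<lambda>x. ereal ((A *v x) \<bullet> x) + - ereal (v x))"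
    using tilde A x0(1) CX unfolding PSH_tilde_def SA_def X_def by blast
  define f where "f = (\<lambda>x. (A *v x) \<bullet> x - v x)"
  \<comment> \<open>The terms linear in \<open>h = x - x0\<close>: two from the quadratic function of \<open>A\<close>, one from the
    Taylor expansion of \<open>U\<close>, and one from \<open>\<epsilon> |x|\<^sup>2\<close>.\<close>
  define l where "l = (\<lambda>h. (A *v x0) \<bullet> h + (A *v h) \<bullet> x0 - (b \<bullet> h) / M - 2 * \<epsilon> * (x0 \<bullet> h))"
  have "linear l"
    unfolding l_def
    by (rule linearI) (simp_all add: matrix_vector_right_distrib matrix_vector_mult_scaleR
        inner_add_left inner_add_right algebra_simps add_divide_distrib)
  define a where "a = (\<lambda>x. l x + (f x0 - l x0))"
  have "subaffine W (\<lambda>x. ereal (f x))"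
    using W(3) by (simp add: f_def)
  then show False
  proof (rule subaffine_no_strict_touching[OF _ W(1,2) _ _ \<epsilon>(1) d(1)])
    show "affine_fun a" using \<open>linear l\<close> unfolding affine_fun_def a_def by blast
    show "a x0 = f x0" by (simp add: a_def)
    fix x assume x: "x \<in> cball x0 d"
    define h where "h = x - x0"
    have xh: "x = x0 + h" by (simp add: h_def)
    have "G x \<le> G x0" using x dC x0(2) by blast
    moreover have "norm x ^ 2 = norm x0 ^ 2 + 2 * (x0 \<bullet> h) + norm h ^ 2"
      by (simp add: xh power2_norm_eq_inner inner_add_left inner_add_right inner_commute)
    ultimately have "U x - v x + \<epsilon> * (2 * (x0 \<bullet> h) + norm h ^ 2) \<le> U x0 - v x0"
      by (simp add: G_def algebra_simps)
    moreover have "f x + v x = f x0 + v x0 + (A *v x0) \<bullet> h + (A *v h) \<bullet> x0 + (A *v h) \<bullet> h"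
      by (simp add: f_def xh matrix_vector_right_distrib inner_add_left inner_add_right)
    moreover have "a x = f x0 + l h"
      using linear_add[OF \<open>linear l\<close>, of x0 h] by (simp add: a_def xh)
    ultimately show "f x \<le> a x - \<epsilon> * norm (x - x0) ^ 2 + (B / M) * norm (x - x0) ^ 3"
      using T'[of h] by (simp add: l_def xh algebra_simps)
  qed
qed

theorem theorem7p1:
  fixes P :: "(real^'n^'n) set"
    and K :: "(real^'n) set"
    and u1 u2 :: "real^'n \<Rightarrow> real"
  assumes "elliptic_cone P"
    and "compact K"
    and "continuous_on K u1" and "continuous_on K u2"
    and "partially_pluriharmonic P (interior K) (\<lambda>x. ereal (u1 x))"
    and "partially_pluriharmonic P (interior K) (\<lambda>x. ereal (u2 x))"
    and "\<forall>x\<in>frontier K. u1 x = u2 x"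
  shows "\<forall>x\<in>K. u1 x = u2 x"
proof
  fix x assume x: "x \<in> K"
  have P: "P \<subseteq> Sym2" "closed P" "convex_cone P"
    using assms(1) by (auto simp: elliptic_cone_def)
  have psh: "psh_distr P (interior K) (regular_distr (interior K) (\<lambda>x. ereal (u1 x)))"
    "psh_distr P (interior K) (regular_distr (interior K) (\<lambda>x. ereal (u2 x)))"
    and tilde: "(\<lambda>x. - ereal (u1 x)) \<in> PSH_tilde P (interior K)"
    "(\<lambda>x. - ereal (u2 x)) \<in> PSH_tilde P (interior K)"
    using assms(5,6) by (auto simp: partially_pluriharmonic_def PSH_def)
  have "u1 x \<le> u2 x"
    by (rule comparison_principle[OF P assms(2,3,4) psh(1) tilde(2) _ x]) (simp add: assms(7))
  moreover have "u2 x \<le> u1 x"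
    by (rule comparison_principle[OF P assms(2,4,3) psh(2) tilde(1) _ x]) (simp add: assms(7))
  ultimately show "u1 x = u2 x" by simp
qed

end
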